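(* Let $n\ge k$ be positive integers, $f_k$ the $k$-clique Boolean function on $n$ vertices, and $X_k$ the set of the $\binom k2$ edge variables among some fixed set of $k$ vertices. If $f_k^{restricted}(X_k)=C_1\vee C_2\vee\dots\vee C_m$ is written in disjunctive normal form, then each clause $C_i$ ($1\le i\le m$) contains all of the variables in $X_k$.
   Context: The $k$-clique function $f_k$ takes as input a graph on vertex set $\{1,\dots,n\}$ encoded by $\binom n2$ bits $e_{ij}$ ($i<j$), $e_{ij}=1$ meaning the edge $\{i,j\}$ is present; $f_k=1$ iff the graph contains a clique on $k$ vertices. For a Boolean function $f$ and a subset $X$ of its variables, $f^{restricted}(X)$ denotes the Boolean function of the variables in $X$ obtained from $f$ by assigning the value $0$ to every variable not in $X$. A disjunctive normal form is a disjunction of clauses, each clause being a conjunction of literals (variables or negated variables).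
   Formalization: Clauses are assumed to contain no variable together with its negation; without this the claim fails, e.g. for n=k=3 with edge variables a, b, c the form (a∧b∧c)∨(a∧¬a) has a clause missing b and c. *)

theory Defs
  imports Main
begin

text \<open>
  A variable \<open>e\<^sub>i\<^sub>j\<close> with \<open>i < j\<close> is the pair \<open>(i, j)\<close>. A Boolean function is a predicate on total
  assignments, and a function of the variables in \<open>X\<close> is one that ignores the values outside \<open>X\<close>.
\<close>

type_synonym edge_var = "nat \<times> nat"
type_synonym 'v assignment = "'v \<Rightarrow> bool"
type_synonym 'v boolfun = "'v assignment \<Rightarrow> bool"

definition edge_vars :: "nat set \<Rightarrow> edge_var set" where
  "edge_vars V = {(i, j). i \<in> V \<and> j \<in> V \<and> i < j}"

definition clique_fun :: "nat \<Rightarrow> nat \<Rightarrow> edge_var boolfun" where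
  "clique_fun n k e \<longleftrightarrow>
     (\<exists>S \<subseteq> {1..n}. card S = k \<and> (\<forall>i\<in>S. \<forall>j\<in>S. i < j \<longrightarrow> e (i, j)))"

definition restricted :: "'v boolfun \<Rightarrow> 'v set \<Rightarrow> 'v boolfun" where
  "restricted f X a = f (\<lambda>x. if x \<in> X then a x else False)"

datatype 'v lit = Pos (var: 'v) | Neg (var: 'v)

fun lit_val :: "'v lit \<Rightarrow> 'v boolfun" where
  "lit_val (Pos x) a \<longleftrightarrow> a x"
| "lit_val (Neg x) a \<longleftrightarrow> \<not> a x"

type_synonym 'v clause = "'v lit set"

definition clause_val :: "'v clause \<Rightarrow> 'v boolfun" where
  "clause_val C a \<longleftrightarrow> (\<forall>l\<in>C. lit_val l a)"

definition dnf_val :: "'v clause list \<Rightarrow> 'v boolfun" where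
  "dnf_val Cs a \<longleftrightarrow> (\<exists>C\<in>set Cs. clause_val C a)"

text \<open>
  The usual convention on the clauses of a disjunctive normal form: no variable occurs together with
  its negation. Otherwise identically false clauses such as \<open>x \<and> \<not> x\<close> could be added to any
  disjunctive normal form without changing the function it represents.
\<close>

definition consistent :: "'v clause \<Rightarrow> bool" where
  "consistent C \<longleftrightarrow> (\<nexists>x. Pos x \<in> C \<and> Neg x \<in> C)"

definition dnf_over :: "'v set \<Rightarrow> 'v clause list \<Rightarrow> bool" where
  "dnf_over X Cs \<longleftrightarrow> (\<forall>C\<in>set Cs. finite C \<and> var ` C \<subseteq> X)"

end

theory Submission
  imports Defs
begin

text \<open>
  Making exactly the positive literals of a consistent clause true satisfies that clause, so the
  resulting graph on the fixed \<open>k\<close> vertices has a \<open>k\<close>-clique. For \<open>k \<ge> 2\<close> every vertex of this clique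
  has an incident edge, so it lies among the fixed vertices and the clique is complete on all of them.
\<close>

lemma consistent_clause_val_Pos:
  assumes "consistent C"
  shows "clause_val C (\<lambda>x. Pos x \<in> C)"
  unfolding clause_val_def
proof
  fix l assume "l \<in> C"
  with assms show "lit_val l (\<lambda>x. Pos x \<in> C)"
    by (cases l) (auto simp: consistent_def)
qed

lemma restricted_clique_fun_imp_all_edges:
  assumes "restricted (clique_fun n (card K)) (edge_vars K) a"
    and "finite K" and x: "x \<in> edge_vars K"
  shows "a x"
proof -
  \<comment> \<open>The restriction makes every variable outside \<open>edge_vars K\<close> false,
    so each edge of the clique \<open>S\<close> is a variable of \<open>edge_vars K\<close>.\<close>
  obtain S where S: "card S = card K"
    "\<And>i j. i \<in> S \<Longrightarrow> j \<in> S \<Longrightarrow> i < j \<Longrightarrow> (i, j) \<in> edge_vars K \<and> a (i, j)"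
    using assms(1) unfolding restricted_def clique_fun_def by metis
  obtain p q where pq: "x = (p, q)" "p \<in> K" "q \<in> K" "p < q"
    using x by (auto simp: edge_vars_def)
  \<comment> \<open>The variable \<open>x\<close> itself supplies two vertices of \<open>K\<close>.
    This excludes \<open>card K = 1\<close>, where \<open>S\<close> could be any single
    vertex.\<close>
  have "card {p, q} \<le> card K"
    using pq \<open>finite K\<close> by (intro card_mono) auto
  then have "2 \<le> card S"
    using pq S(1) by simp
  have "S \<subseteq> K"
  proof
    fix i assume "i \<in> S"
    \<comment> \<open>Only an edge at \<open>i\<close> shows that \<open>i\<close> lies in
      \<open>K\<close>, hence the second vertex \<open>j\<close>.\<close>
    obtain j where "j \<in> S" "j \<noteq> i"
    proof -
      have "\<not> S \<subseteq> {i}"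
        using \<open>2 \<le> card S\<close> card_mono[of "{i}" S] by auto
      then show ?thesis
        using that by auto
    qed
    then show "i \<in> K"
      using S(2)[of i j] S(2)[of j i] \<open>i \<in> S\<close> by (auto simp: edge_vars_def neq_iff)
  qed
  then have "S = K"
    using S(1) \<open>finite K\<close> by (simp add: card_subset_eq)
  then show ?thesis
    using S(2) pq by auto
qed

theorem theorem2:
  fixes n k :: nat and K :: "nat set" and Cs :: "edge_var clause list"
  assumes "1 \<le> k" and "k \<le> n"
    and "K \<subseteq> {1..n}" and "card K = k"
    and "dnf_over (edge_vars K) Cs"
    and "\<forall>C\<in>set Cs. consistent C"
    and "restricted (clique_fun n k) (edge_vars K) = dnf_val Cs"
  shows "\<forall>i<length Cs. \<forall>x\<in>edge_vars K. Pos x \<in> Cs ! i"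
proof (intro allI impI ballI)
  fix i x assume "i < length Cs" and x: "x \<in> edge_vars K"
  then have C: "Cs ! i \<in> set Cs"
    by simp
  \<comment> \<open>At this assignment, \<open>x\<close> being true means literally that
    \<open>Pos x\<close> is in the clause.\<close>
  then have "dnf_val Cs (\<lambda>x. Pos x \<in> Cs ! i)"
    unfolding dnf_val_def using assms(6) consistent_clause_val_Pos by blast
  then have "restricted (clique_fun n (card K)) (edge_vars K) (\<lambda>x. Pos x \<in> Cs ! i)"
    using assms(4,7) by simp
  moreover have "finite K"
    using assms(3) finite_subset by blast
  ultimately show "Pos x \<in> Cs ! i"
    using x by (rule restricted_clique_fun_imp_all_edges)
qed

end
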